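(* Let $T>0$, $\varepsilon>0$ and assume the following. (1) $(\mathcal M,g)$ is a Riemannian manifold, where $\mathcal M$ is of class $C^3$, compact and geodesically strongly convex with $C^1$ boundary; $\widetilde{\mathcal M}$ is a finite subset of $\mathcal M$; $\Gamma\subset\mathcal M$ and $\widetilde\Gamma\subset\widetilde{\mathcal M}$ are closed, $\mathcal M\setminus\Gamma$ is open and $\widetilde{\mathcal M}\setminus\widetilde\Gamma\subset\mathcal M\setminus\Gamma$. (2) $P\in\mathrm{Lip}(\mathcal M\setminus\Gamma)$ and $\widetilde P\in\mathrm{Lip}(\widetilde{\mathcal M}\setminus\widetilde\Gamma)$ are non-negative; $f_0\in\mathrm{Lip}(\mathcal M)$ and $f_0^\varepsilon\in\mathrm{Lip}(\widetilde{\mathcal M})$. (3) $\eta:[0,+\infty)\to[0,+\infty)$ satisfies $\mathrm{supp}(\eta)\subset[0,r_\eta]$ for some $r_\eta>0$; there is $a\in]0,r_\eta[$ such that $\eta$ is decreasing on $[0,a]$ and $\eta(a)>0$; $C_\eta:=\sup_{t\ge0}t\eta(t)>0$. (4) There exists $\widetilde\psi_b\in\mathrm{Lip}(\mathcal M)$ with $\widetilde\psi_b(x)=f_0^\varepsilon(x)$ for all $x\in\widetilde\Gamma$ such that $\widetilde\psi_b$ is a viscosity sub-solution of the problem $(\mathcal P_\varepsilon)$ in $\widetilde{\mathcal M}_T$. Then $(\mathcal P_\varepsilon)$ admits a unique viscosity solution $f^\varepsilon$ (which is in fact continuous). Moreover, there exists a function $\bar f^\varepsilon\in\mathrm{Lip}(\widetilde{\mathcal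 M})$ such that $$\widetilde\psi_b\le f^\varepsilon\le\bar f^\varepsilon\quad\text{in }\widetilde{\mathcal M}_T.$$
   Context: $\mathrm{Lip}(A)$ is the set of real functions on $A\subset\mathcal M$ that are Lipschitz for the Riemannian distance $d_{\mathcal M}$. "Geodesically strongly convex" means that every two points of $\mathcal M$ are joined by a unique minimizing geodesic, whose interior lies in the interior of $\mathcal M$. $\widetilde d$ is an approximation of the distance function $d_{\mathcal M}$. The functions $P,f_0$ are the data of a companion local problem and do not enter $(\mathcal P_\varepsilon)$. Problem $(\mathcal P_\varepsilon)$, with $\widetilde{\mathcal M}_T=\widetilde{\mathcal M}\times[0,T]$ and $\partial\widetilde{\mathcal M}_T=(\widetilde\Gamma\times]0,T[)\cup(\widetilde{\mathcal M}\times\{0\})$: $$\partial_tf^\varepsilon(x,t)+|\nabla^-_{\eta_\varepsilon}f^\varepsilon(x,t)|_\infty=\widetilde P(x)\ \text{ on }(\widetilde{\mathcal M}\setminus\widetilde\Gamma)\times]0,T[,\qquad f^\varepsilon=f_0^\varepsilon\ \text{ on }\partial\widetilde{\mathcal M}_T,$$ $$|\nabla^-_{\eta_\varepsilon}f^\varepsilon(x,t)|_\infty=\max_{y\in\widetilde{\mathcal M}}\frac1{\varepsilon C_\eta}\,\eta\Big(\frac{\widetilde d(x,y)}\varepsilon\Big)\big(f^\varepsilon(x,t)-f^\varepsilon(y,t)\big).$$ An usc $f^\varepsilon:\widetilde{\mathcal M}_T\to\mathbb R$ is a viscosity sub-solution in $\widetilde{\mathcal M}_T$ if $f^\varepsilon\le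 f_0^\varepsilon$ on $\partial\widetilde{\mathcal M}_T$ and for every $x_0\in\widetilde{\mathcal M}\setminus\widetilde\Gamma$, $\varphi\in C^1(]0,T[)$ and local maximum point $t_0\in]0,T[$ of $f^\varepsilon(x_0,\cdot)-\varphi$, $\varphi'(t_0)+|\nabla^-_{\eta_\varepsilon}f^\varepsilon(x_0,t_0)|_\infty\le\widetilde P(x_0)$ (a function of $x$ only, such as $\widetilde\psi_b$, is viewed as time-independent). Super-solutions (lsc) are defined symmetrically (local minimum, reversed inequalities, $f^\varepsilon\ge f_0^\varepsilon$ on $\partial\widetilde{\mathcal M}_T$). A locally bounded $f^\varepsilon:\widetilde{\mathcal M}_T\to\mathbb R$ is a viscosity solution if its usc envelope $(f^\varepsilon)^*$ is a sub-solution and its lsc envelope $(f^\varepsilon)_*$ is a super-solution.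
   Formalization: Uniqueness is stated on [0,T[ for all viscosity solutions and on [0,T] only for continuous ones, since the definitions do not constrain values at t = T (for zero data, changing f = 0 at one point (x,T) gives another solution). *)

theory Defs
  imports "HOL-Analysis.Analysis"
begin

text \<open>
  Manifolds of class \<open>C\<^sup>3\<close> with \<open>C\<^sup>1\<close> boundary.  The charts take values in domains of a
  Euclidean space with \<open>C\<^sup>1\<close> boundary, and the transition maps are \<open>C\<^sup>3\<close> up to the boundary.  With
  half-space charts instead, \<open>C\<^sup>3\<close> transition maps would force the boundary to be \<open>C\<^sup>3\<close>, and
  \<open>C\<^sup>1\<close> transition maps would lose the \<open>C\<^sup>3\<close> structure.
\<close>

primrec Ck_open :: "nat \<Rightarrow> 'e::euclidean_space set \<Rightarrow> ('e \<Rightarrow> 'f::real_normed_vector) \<Rightarrow> bool" where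
  "Ck_open 0 W F \<longleftrightarrow> continuous_on W F"
| "Ck_open (Suc k) W F \<longleftrightarrow>
     (\<forall>z\<in>W. F differentiable (at z)) \<and>
     (\<forall>v. Ck_open k W (\<lambda>z. frechet_derivative F (at z) v))"

definition Ck_on :: "nat \<Rightarrow> 'e::euclidean_space set \<Rightarrow> ('e \<Rightarrow> 'f::real_normed_vector) \<Rightarrow> bool" where
  "Ck_on k S f \<longleftrightarrow>
     (\<forall>z\<in>S. \<exists>W F. open W \<and> z \<in> W \<and> Ck_open k W F \<and> (\<forall>w\<in>S \<inter> W. F w = f w))"

definition C1_domain :: "'e::euclidean_space set \<Rightarrow> bool" where
  "C1_domain D \<longleftrightarrow>
     (\<forall>z\<in>D. \<exists>W. open W \<and> z \<in> W \<and>
        (W \<subseteq> D \<or>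
         (\<exists>\<rho> :: 'e \<Rightarrow> real. Ck_open 1 W \<rho> \<and> \<rho> z = 0 \<and> (\<exists>v. frechet_derivative \<rho> (at z) v \<noteq> 0) \<and>
            D \<inter> W = {w\<in>W. \<rho> w \<le> 0})))"

type_synonym ('a, 'e) chart = "'a set \<times> ('a \<Rightarrow> 'e)"

definition transition :: "('a, 'e) chart \<Rightarrow> ('a, 'e) chart \<Rightarrow> 'e \<Rightarrow> 'e" where
  "transition c d = snd d \<circ> inv_into (fst c) (snd c)"

definition C3_manifold_C1_boundary ::
    "'a::t2_space set \<Rightarrow> ('a, 'e::euclidean_space) chart set \<Rightarrow> bool" where
  "C3_manifold_C1_boundary M \<A> \<longleftrightarrow>
     \<Union> (fst ` \<A>) = M \<and>
     (\<forall>c\<in>\<A>. openin (top_of_set M) (fst c) \<and>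
        homeomorphism (fst c) (snd c ` fst c) (snd c) (inv_into (fst c) (snd c)) \<and>
        C1_domain (snd c ` fst c)) \<and>
     (\<forall>c\<in>\<A>. \<forall>d\<in>\<A>. Ck_on 3 (snd c ` (fst c \<inter> fst d)) (transition c d))"

definition manifold_interior :: "('a, 'e::euclidean_space) chart set \<Rightarrow> 'a set" where
  "manifold_interior \<A> = {p. \<exists>c\<in>\<A>. p \<in> fst c \<and> snd c p \<in> interior (snd c ` fst c)}"

text \<open>
  A metric is given by its coordinate expressions: \<open>g c p v w\<close> is the inner product of the tangent
  vectors at \<open>p\<close> whose coordinates in the chart \<open>c\<close> are \<open>v\<close> and \<open>w\<close>.  \<open>C\<^sup>2\<close> is the highest
  regularity that is invariant under \<open>C\<^sup>3\<close> changes of coordinates.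
\<close>

type_synonym ('a, 'e) metric_field = "('a, 'e) chart \<Rightarrow> 'a \<Rightarrow> 'e \<Rightarrow> 'e \<Rightarrow> real"

definition riemannian_metric ::
    "('a, 'e::euclidean_space) chart set \<Rightarrow> ('a, 'e) metric_field \<Rightarrow> bool" where
  "riemannian_metric \<A> g \<longleftrightarrow>
     (\<forall>c\<in>\<A>. \<forall>p\<in>fst c. bilinear (g c p) \<and> (\<forall>v w. g c p v w = g c p w v) \<and>
        (\<forall>v. v \<noteq> 0 \<longrightarrow> 0 < g c p v v)) \<and>
     (\<forall>c\<in>\<A>. \<forall>v w. Ck_on 2 (snd c ` fst c) (\<lambda>z. g c (inv_into (fst c) (snd c) z) v w)) \<and>
     (\<forall>c\<in>\<A>. \<forall>d\<in>\<A>. \<forall>p\<in>fst c \<inter> fst d. \<forall>D.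
        (transition c d has_derivative D) (at (snd c p) within snd c ` (fst c \<inter> fst d)) \<longrightarrow>
        (\<forall>v w. g c p v w = g d p (D v) (D w)))"

definition riemannian_manifold ::
    "'a::t2_space set \<Rightarrow> ('a, 'e::euclidean_space) chart set \<Rightarrow> ('a, 'e) metric_field \<Rightarrow> bool" where
  "riemannian_manifold M \<A> g \<longleftrightarrow> C3_manifold_C1_boundary M \<A> \<and> riemannian_metric \<A> g"

definition C1_curve_on ::
    "('a::topological_space, 'e::euclidean_space) chart set \<Rightarrow> real \<Rightarrow> real \<Rightarrow> (real \<Rightarrow> 'a) \<Rightarrow> bool" where
  "C1_curve_on \<A> a b \<gamma> \<longleftrightarrow>
     (\<forall>c\<in>\<A>. let J = {t\<in>{a..b}. \<gamma> t \<in> fst c} in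
        \<exists>v. continuous_on J v \<and> (\<forall>t\<in>J. (snd c \<circ> \<gamma> has_vector_derivative v t) (at t within J)))"

definition piecewise_C1_curve ::
    "'a::t2_space set \<Rightarrow> ('a, 'e::euclidean_space) chart set \<Rightarrow> (real \<Rightarrow> 'a) \<Rightarrow> bool" where
  "piecewise_C1_curve M \<A> \<gamma> \<longleftrightarrow>
     path \<gamma> \<and> path_image \<gamma> \<subseteq> M \<and>
     (\<exists>breaks. finite breaks \<and>
        (\<forall>a b. 0 \<le> a \<and> a < b \<and> b \<le> 1 \<and> {a<..<b} \<inter> breaks = {} \<longrightarrow> C1_curve_on \<A> a b \<gamma>))"

text \<open>The speed does not depend on the chart that is chosen, by the transformation rule of \<open>g\<close>.\<close>

definition speed ::
    "('a, 'e::euclidean_space) chart set \<Rightarrow> ('a, 'e) metric_field \<Rightarrow> (real \<Rightarrow> 'a) \<Rightarrow> real \<Rightarrow> real" where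
  "speed \<A> g \<gamma> t =
     (let c = (SOME c. c \<in> \<A> \<and> \<gamma> t \<in> fst c);
          v = vector_derivative (snd c \<circ> \<gamma>) (at t)
      in sqrt (g c (\<gamma> t) v v))"

definition curve_length ::
    "('a, 'e::euclidean_space) chart set \<Rightarrow> ('a, 'e) metric_field \<Rightarrow> (real \<Rightarrow> 'a) \<Rightarrow> real \<Rightarrow> real \<Rightarrow> real" where
  "curve_length \<A> g \<gamma> s t = integral {s..t} (speed \<A> g \<gamma>)"

definition riem_dist ::
    "'a::t2_space set \<Rightarrow> ('a, 'e::euclidean_space) chart set \<Rightarrow> ('a, 'e) metric_field \<Rightarrow>
     'a \<Rightarrow> 'a \<Rightarrow> real" where
  "riem_dist M \<A> g x y =
     (INF \<gamma>\<in>{\<gamma>. piecewise_C1_curve M \<A> \<gamma> \<and> \<gamma> 0 = x \<and> \<gamma> 1 = y}. curve_length \<A> g \<gamma> 0 1)"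

text \<open>
  On a manifold with boundary, minimizing geodesics are the shortest curves in the manifold,
  parametrized on \<open>[0,1]\<close> proportionally to arc length.
\<close>

definition minimizing_geodesic ::
    "'a::t2_space set \<Rightarrow> ('a, 'e::euclidean_space) chart set \<Rightarrow> ('a, 'e) metric_field \<Rightarrow>
     'a \<Rightarrow> 'a \<Rightarrow> (real \<Rightarrow> 'a) \<Rightarrow> bool" where
  "minimizing_geodesic M \<A> g x y \<gamma> \<longleftrightarrow>
     piecewise_C1_curve M \<A> \<gamma> \<and> \<gamma> 0 = x \<and> \<gamma> 1 = y \<and>
     (\<forall>t\<in>{0..1}. curve_length \<A> g \<gamma> 0 t = t * riem_dist M \<A> g x y)"

text \<open>
  The case \<open>x = y\<close> is left out: a constant curve at a boundary point does not meet the interior.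
\<close>

definition geodesically_strongly_convex ::
    "'a::t2_space set \<Rightarrow> ('a, 'e::euclidean_space) chart set \<Rightarrow> ('a, 'e) metric_field \<Rightarrow> bool" where
  "geodesically_strongly_convex M \<A> g \<longleftrightarrow>
     (\<forall>x\<in>M. \<forall>y\<in>M. x \<noteq> y \<longrightarrow>
        (\<exists>\<gamma>. minimizing_geodesic M \<A> g x y \<gamma> \<and> \<gamma> ` {0<..<1} \<subseteq> manifold_interior \<A> \<and>
             (\<forall>\<delta>. minimizing_geodesic M \<A> g x y \<delta> \<longrightarrow> (\<forall>t\<in>{0..1}. \<delta> t = \<gamma> t))))"

definition Lip :: "('a \<Rightarrow> 'a \<Rightarrow> real) \<Rightarrow> 'a set \<Rightarrow> ('a \<Rightarrow> real) set" where
  "Lip d S = {f. \<exists>L\<ge>0. \<forall>x\<in>S. \<forall>y\<in>S. \<bar>f x - f y\<bar> \<le> L * d x y}"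

text \<open>
  The supremum \<open>C\<^sub>\<eta>\<close> is taken in the extended reals, so that \<open>1 / (\<epsilon> C\<^sub>\<eta>)\<close> is meaningful
  (and equal to 0) also when \<open>s \<mapsto> s \<eta>(s)\<close> is unbounded.
\<close>

definition C_eta :: "(real \<Rightarrow> real) \<Rightarrow> ereal" where
  "C_eta \<eta> = (SUP s\<in>{0..}. ereal (s * \<eta> s))"

definition nl_grad_minus ::
    "'a set \<Rightarrow> real \<Rightarrow> (real \<Rightarrow> real) \<Rightarrow> ('a \<Rightarrow> 'a \<Rightarrow> real) \<Rightarrow> ('a \<times> real \<Rightarrow> real) \<Rightarrow> 'a \<Rightarrow> real \<Rightarrow> real" where
  "nl_grad_minus X \<epsilon> \<eta> dt u x t =
     Max ((\<lambda>y. real_of_ereal (1 / (ereal \<epsilon> * C_eta \<eta>)) * \<eta> (dt x y / \<epsilon>) * (u (x, t) - u (y, t))) ` X)"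

definition parabolic_boundary :: "'a set \<Rightarrow> 'a set \<Rightarrow> real \<Rightarrow> ('a \<times> real) set" where
  "parabolic_boundary X \<Gamma>t T = \<Gamma>t \<times> {0<..<T} \<union> X \<times> {0}"

definition usc_on :: "'b::topological_space set \<Rightarrow> ('b \<Rightarrow> real) \<Rightarrow> bool" where
  "usc_on S f \<longleftrightarrow> (\<forall>z\<in>S. \<forall>c>f z. \<forall>\<^sub>F w in at z within S. f w < c)"

definition lsc_on :: "'b::topological_space set \<Rightarrow> ('b \<Rightarrow> real) \<Rightarrow> bool" where
  "lsc_on S f \<longleftrightarrow> (\<forall>z\<in>S. \<forall>c<f z. \<forall>\<^sub>F w in at z within S. c < f w)"

text \<open>
  The filter below does not exclude the point \<open>z\<close> itself.  The values are finite where \<open>f\<close> is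
  locally bounded.
\<close>

definition usc_envelope :: "'b::topological_space set \<Rightarrow> ('b \<Rightarrow> real) \<Rightarrow> 'b \<Rightarrow> real" where
  "usc_envelope S f z = real_of_ereal (Limsup (inf (nhds z) (principal S)) (\<lambda>w. ereal (f w)))"

definition lsc_envelope :: "'b::topological_space set \<Rightarrow> ('b \<Rightarrow> real) \<Rightarrow> 'b \<Rightarrow> real" where
  "lsc_envelope S f z = real_of_ereal (Liminf (inf (nhds z) (principal S)) (\<lambda>w. ereal (f w)))"

definition locally_bounded_on :: "'b::topological_space set \<Rightarrow> ('b \<Rightarrow> real) \<Rightarrow> bool" where
  "locally_bounded_on S f \<longleftrightarrow>
     (\<forall>z\<in>S. \<exists>U. openin (top_of_set S) U \<and> z \<in> U \<and> bounded (f ` U))"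

definition visc_subsolution ::
    "'a::topological_space set \<Rightarrow> 'a set \<Rightarrow> real \<Rightarrow> real \<Rightarrow> (real \<Rightarrow> real) \<Rightarrow> ('a \<Rightarrow> 'a \<Rightarrow> real) \<Rightarrow>
     ('a \<Rightarrow> real) \<Rightarrow> ('a \<Rightarrow> real) \<Rightarrow> ('a \<times> real \<Rightarrow> real) \<Rightarrow> bool" where
  "visc_subsolution X \<Gamma>t T \<epsilon> \<eta> dt Pt f0\<epsilon> u \<longleftrightarrow>
     usc_on (X \<times> {0..T}) u \<and>
     (\<forall>(x, t)\<in>parabolic_boundary X \<Gamma>t T. u (x, t) \<le> f0\<epsilon> x) \<and>
     (\<forall>x0\<in>X - \<Gamma>t. \<forall>\<phi>. \<phi> C1_differentiable_on {0<..<T} \<longrightarrow>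
        (\<forall>t0\<in>{0<..<T}.
           (\<forall>\<^sub>F t in nhds t0. u (x0, t) - \<phi> t \<le> u (x0, t0) - \<phi> t0) \<longrightarrow>
           deriv \<phi> t0 + nl_grad_minus X \<epsilon> \<eta> dt u x0 t0 \<le> Pt x0))"

definition visc_supersolution ::
    "'a::topological_space set \<Rightarrow> 'a set \<Rightarrow> real \<Rightarrow> real \<Rightarrow> (real \<Rightarrow> real) \<Rightarrow> ('a \<Rightarrow> 'a \<Rightarrow> real) \<Rightarrow>
     ('a \<Rightarrow> real) \<Rightarrow> ('a \<Rightarrow> real) \<Rightarrow> ('a \<times> real \<Rightarrow> real) \<Rightarrow> bool" where
  "visc_supersolution X \<Gamma>t T \<epsilon> \<eta> dt Pt f0\<epsilon> u \<longleftrightarrow>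
     lsc_on (X \<times> {0..T}) u \<and>
     (\<forall>(x, t)\<in>parabolic_boundary X \<Gamma>t T. f0\<epsilon> x \<le> u (x, t)) \<and>
     (\<forall>x0\<in>X - \<Gamma>t. \<forall>\<phi>. \<phi> C1_differentiable_on {0<..<T} \<longrightarrow>
        (\<forall>t0\<in>{0<..<T}.
           (\<forall>\<^sub>F t in nhds t0. u (x0, t0) - \<phi> t0 \<le> u (x0, t) - \<phi> t) \<longrightarrow>
           Pt x0 \<le> deriv \<phi> t0 + nl_grad_minus X \<epsilon> \<eta> dt u x0 t0))"

definition visc_solution ::
    "'a::topological_space set \<Rightarrow> 'a set \<Rightarrow> real \<Rightarrow> real \<Rightarrow> (real \<Rightarrow> real) \<Rightarrow> ('a \<Rightarrow> 'a \<Rightarrow> real) \<Rightarrow>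
     ('a \<Rightarrow> real) \<Rightarrow> ('a \<Rightarrow> real) \<Rightarrow> ('a \<times> real \<Rightarrow> real) \<Rightarrow> bool" where
  "visc_solution X \<Gamma>t T \<epsilon> \<eta> dt Pt f0\<epsilon> f \<longleftrightarrow>
     locally_bounded_on (X \<times> {0..T}) f \<and>
     visc_subsolution X \<Gamma>t T \<epsilon> \<eta> dt Pt f0\<epsilon> (usc_envelope (X \<times> {0..T}) f) \<and>
     visc_supersolution X \<Gamma>t T \<epsilon> \<eta> dt Pt f0\<epsilon> (lsc_envelope (X \<times> {0..T}) f)"

end

theory Submission
  imports Defs
begin

text \<open>
  Since \<open>Mt\<close> is a finite set, the equation is a finite system of ordinary differential equations
  with a globally Lipschitz right-hand side, one equation for each point of \<open>Mt - \<Gamma>t\<close>, and the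
  Picard iteration yields a solution that is \<open>C\<^sup>1\<close> in time.  It can itself serve as a test function:
  if a sub-solution \<open>v\<close> exceeded it, then at a maximum point of the difference \<open>v - u\<close>, penalized near
  the final time, the monotonicity of the non-local gradient in the differences \<open>u x - u y\<close> would
  give a contradiction, and similarly for super-solutions.  Uniqueness and the lower bound follow
  by comparison; the upper bound can be taken constant, by compactness.
\<close>

subsection \<open>Systems of ordinary differential equations\<close>

text \<open>The increment of \<open>F\<close> is squeezed by \<open>L\<close> times a bound on the
  increments of all coordinates. The sum over \<open>X\<close> serves as this bound: it dominates
  each of its terms and its limit can be taken term by term.\<close>

lemma continuous_on_lipschitz_field:
  fixes F :: "('a \<Rightarrow> real) \<Rightarrow> real" and S :: "real set"
  assumes "finite X"
    and lip: "\<And>u v c. (\<And>y. y \<in> X \<Longrightarrow> \<bar>u y - v y\<bar> \<le> c) \<Longrightarrow> \<bar>F u - F v\<bar> \<le> L * c"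
    and cont: "\<And>y. y \<in> X \<Longrightarrow> continuous_on S (u y)"
  shows "continuous_on S (\<lambda>t. F (\<lambda>y. u y t))"
  unfolding continuous_on_def
proof
  fix s assume s: "s \<in> S"
  let ?c = "\<lambda>t. \<Sum>y\<in>X. \<bar>u y t - u y s\<bar>"
  have bound: "norm (F (\<lambda>y. u y t) - F (\<lambda>y. u y s)) \<le> L * ?c t" for t
    unfolding real_norm_def
    by (rule lip, rule member_le_sum) (use \<open>finite X\<close> in auto)
  have "((\<lambda>t. u y t) \<longlongrightarrow> u y s) (at s within S)" if "y \<in> X" for y
    using cont[OF that] s by (simp add: continuous_on_def)
  then have "((\<lambda>t. L * ?c t) \<longlongrightarrow> L * (\<Sum>y\<in>X. \<bar>u y s - u y s\<bar>)) (at s within S)"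
    by (intro tendsto_intros)
  then have "((\<lambda>t. L * ?c t) \<longlongrightarrow> 0) (at s within S)"
    by simp
  then have "((\<lambda>t. F (\<lambda>y. u y t) - F (\<lambda>y. u y s)) \<longlongrightarrow> 0) (at s within S)"
    by (rule Lim_null_comparison[rotated]) (simp only: bound eventually_True)
  then show "((\<lambda>t. F (\<lambda>y. u y t)) \<longlongrightarrow> F (\<lambda>y. u y s)) (at s within S)"
    by (rule LIM_zero_cancel)
qed

text \<open>
  Weighting the supremum norm by \<open>exp (2 * L * t)\<close> makes the Picard operator a contraction by the
  factor \<open>1 / 2\<close> on the whole of \<open>{0..T}\<close>, so no gluing of short-time solutions is needed.
\<close>

lemma picard_lindelof_finite_system:
  fixes F :: "('a \<Rightarrow> real) \<Rightarrow> 'a \<Rightarrow> real" and u0 :: "'a \<Rightarrow> real"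
  assumes "finite X" and L: "L > 0"
    and lip: "\<And>u v c x. x \<in> X \<Longrightarrow> (\<And>y. y \<in> X \<Longrightarrow> \<bar>u y - v y\<bar> \<le> c) \<Longrightarrow> \<bar>F u x - F v x\<bar> \<le> L * c"
  obtains u where "\<And>x. x \<in> X \<Longrightarrow> u x 0 = u0 x"
    and "\<And>x t. x \<in> X \<Longrightarrow> t \<in> {0..T} \<Longrightarrow>
      (u x has_real_derivative F (\<lambda>y. u y t) x) (at t within {0..T})"
proof -
  have cont: "continuous_on S (\<lambda>t. F (\<lambda>y. u y t) x)"
    if "x \<in> X" "\<And>y. y \<in> X \<Longrightarrow> continuous_on S (u y)" for x u and S :: "real set"
    using \<open>finite X\<close> lip[OF \<open>x \<in> X\<close>] that(2) by (rule continuous_on_lipschitz_field)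
  define \<Phi> where "\<Phi> u x t = u0 x + integral {0..t} (\<lambda>s. F (\<lambda>y. u y s) x)"
    for u :: "'a \<Rightarrow> real \<Rightarrow> real" and x and t :: real
  have \<Phi>_deriv: "(\<Phi> u x has_real_derivative F (\<lambda>y. u y t) x) (at t within {0..T})"
    if "x \<in> X" "\<And>y. y \<in> X \<Longrightarrow> continuous_on {0..T} (u y)" "t \<in> {0..T}" for u x t
    unfolding \<Phi>_def
    using DERIV_add[OF DERIV_const integral_has_real_derivative[OF cont[OF that(1,2)] that(3)]]
    by simp
  have \<Phi>_cont: "continuous_on {0..T} (\<Phi> u x)"
    if "x \<in> X" "\<And>y. y \<in> X \<Longrightarrow> continuous_on {0..T} (u y)" for u x
    by (rule DERIV_continuous_on, rule \<Phi>_deriv[OF that])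
  have contraction: "\<bar>\<Phi> u x t - \<Phi> v x t\<bar> \<le> c / 2 * exp (2 * L * t)"
    if x: "x \<in> X" and t: "t \<in> {0..T}"
      and cu: "\<And>y. y \<in> X \<Longrightarrow> continuous_on {0..T} (u y)"
      and cv: "\<And>y. y \<in> X \<Longrightarrow> continuous_on {0..T} (v y)"
      and c: "\<And>y s. y \<in> X \<Longrightarrow> s \<in> {0..T} \<Longrightarrow> \<bar>u y s - v y s\<bar> \<le> c * exp (2 * L * s)"
    for u v x t c
  proof -
    have sub: "{0..t} \<subseteq> {0..T}" using t by auto
    have int: "(\<lambda>s. F (\<lambda>y. w y s) x) integrable_on {0..t}"
      if "\<And>y. y \<in> X \<Longrightarrow> continuous_on {0..T} (w y)" for w
      by (intro integrable_continuous_real cont x continuous_on_subset[OF that sub])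
    have "0 \<le> c * exp (2 * L * t)" using c[OF x t] by linarith
    then have "0 \<le> c" by (simp add: zero_le_mult_iff)
    \<comment> \<open>The rate \<open>2 * L\<close> is chosen for this antiderivative: integrating
      \<open>exp (2 * L * s)\<close> divides by \<open>2 * L\<close>, which absorbs \<open>L\<close>
      and leaves the contraction factor 1/2. The term at 0 is dropped later because
      \<open>0 \<le> c\<close>.\<close>
    have exp_int: "((\<lambda>s. L * (c * exp (2 * L * s))) has_integral
        c / 2 * exp (2 * L * t) - c / 2 * exp (2 * L * 0)) {0..t}"
      by (rule fundamental_theorem_of_calculus)
        (use t L in \<open>auto intro!: derivative_eq_intros
          simp: has_real_derivative_iff_has_vector_derivative[symmetric]\<close>)
    have "\<bar>\<Phi> u x t - \<Phi> v x t\<bar> =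
        norm (integral {0..t} (\<lambda>s. F (\<lambda>y. u y s) x - F (\<lambda>y. v y s) x))"
      unfolding \<Phi>_def by (simp add: integral_diff[OF int[OF cu] int[OF cv]])
    also have "\<dots> \<le> integral {0..t} (\<lambda>s. L * (c * exp (2 * L * s)))"
    proof (rule integral_norm_bound_integral)
      show "norm (F (\<lambda>y. u y s) x - F (\<lambda>y. v y s) x) \<le> L * (c * exp (2 * L * s))"
        if "s \<in> {0..t}" for s
        unfolding real_norm_def using that sub by (intro lip x c) auto
    qed (use exp_int in \<open>auto intro!: integrable_diff int cu cv\<close>)
    also have "\<dots> \<le> c / 2 * exp (2 * L * t)"
      using integral_unique[OF exp_int] \<open>0 \<le> c\<close> by simp
    finally show ?thesis .
  qed
  define U where "U n = (\<Phi> ^^ n) (\<lambda>x t. u0 x)" for n :: nat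
  have U_Suc: "U (Suc n) = \<Phi> (U n)" for n by (simp add: U_def)
  have U_cont: "x \<in> X \<Longrightarrow> continuous_on {0..T} (U n x)" for n x
  proof (induction n arbitrary: x)
    case 0 then show ?case by (simp add: U_def)
  next
    case (Suc n) then show ?case unfolding U_Suc by (intro \<Phi>_cont)
  qed
  obtain C where C: "\<And>x t. x \<in> X \<Longrightarrow> t \<in> {0..T} \<Longrightarrow> \<bar>U 1 x t - U 0 x t\<bar> \<le> C"
  proof -
    have "bounded (\<Union>x\<in>X. (\<lambda>t. U 1 x t - U 0 x t) ` {0..T})"
      using \<open>finite X\<close>
      by (intro bounded_UN ballI compact_imp_bounded compact_continuous_image continuous_on_diff U_cont) auto
    then obtain C where "\<forall>r\<in>(\<Union>x\<in>X. (\<lambda>t. U 1 x t - U 0 x t) ` {0..T}). norm r \<le> C"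
      unfolding bounded_iff by blast
    then show thesis by (intro that[of C]) auto
  qed
  have step: "\<bar>U (Suc n) x t - U n x t\<bar> \<le> C * (1/2)^n * exp (2 * L * t)"
    if "x \<in> X" "t \<in> {0..T}" for n x t
    using that
  proof (induction n arbitrary: x t)
    case 0
    have "\<bar>U 1 x t - U 0 x t\<bar> \<le> C" using C 0 by blast
    moreover from this have "C * 1 \<le> C * exp (2 * L * t)"
      using 0 L by (intro mult_left_mono) auto
    ultimately show ?case by simp
  next
    case (Suc n)
    then show ?case
      using contraction[where u="U (Suc n)" and v="U n" and c="C * (1/2)^n", OF Suc.prems U_cont U_cont Suc.IH]
      by (simp add: U_Suc)
  qed
  \<comment> \<open>The increments decay geometrically by \<open>step\<close>, so the telescoping
    series of the iterates converges uniformly by the Weierstrass test.\<close>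
  have "\<exists>w. uniform_limit {0..T} (\<lambda>n. U n x) w sequentially" if x: "x \<in> X" for x
  proof -
    have "uniform_limit {0..T} (\<lambda>n t. \<Sum>i<n. U (Suc i) x t - U i x t)
        (\<lambda>t. \<Sum>i. U (Suc i) x t - U i x t) sequentially"
    proof (rule Weierstrass_m_test)
      show "norm (U (Suc n) x t - U n x t) \<le> \<bar>C\<bar> * (1/2)^n * exp (2 * L * T)" if "t \<in> {0..T}" for n t
      proof -
        have "C * (1/2)^n * exp (2 * L * t) \<le> \<bar>C\<bar> * (1/2)^n * exp (2 * L * T)"
          using that L by (intro mult_mono) auto
        with step[OF x that, of n] show ?thesis unfolding real_norm_def by (rule order_trans)
      qed
      show "summable (\<lambda>n. \<bar>C\<bar> * (1/2)^n * exp (2 * L * T))"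
        by (intro summable_mult2 summable_mult summable_geometric) simp
    qed
    then have "uniform_limit {0..T} (\<lambda>n t. U 0 x t + (\<Sum>i<n. U (Suc i) x t - U i x t))
        (\<lambda>t. U 0 x t + (\<Sum>i. U (Suc i) x t - U i x t)) sequentially"
      by (intro uniform_limit_intros)
    moreover have "U 0 x t + (\<Sum>i<n. U (Suc i) x t - U i x t) = U n x t" for n t
      using sum_lessThan_telescope[of "\<lambda>i. U i x t" n] by simp
    ultimately show ?thesis by auto
  qed
  then obtain u where u: "\<And>x. x \<in> X \<Longrightarrow> uniform_limit {0..T} (\<lambda>n. U n x) (u x) sequentially"
    by metis
  have u_cont: "continuous_on {0..T} (u x)" if "x \<in> X" for x
    by (rule uniform_limit_theorem[OF _ u[OF that]]) (use U_cont that in auto)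
  have fixpoint: "u x t = \<Phi> u x t" if x: "x \<in> X" and t: "t \<in> {0..T}" for x t
  proof (rule LIMSEQ_unique)
    show "(\<lambda>n. U (Suc n) x t) \<longlonglongrightarrow> u x t"
      using tendsto_uniform_limitI[OF u[OF x] t] by (rule LIMSEQ_Suc)
    have "(\<lambda>n. \<Phi> (U n) x t) \<longlonglongrightarrow> \<Phi> u x t"
    proof (rule LIMSEQ_I)
      fix e :: real assume e: "e > 0"
      \<comment> \<open>A uniform distance below \<open>d\<close> is also a weighted one, as the
        weight is at least 1 on \<open>{0..T}\<close>. After the contraction the error is at most
        \<open>d / 2 * exp (2 * L * T) = e / 2\<close>.\<close>
      define d where "d = e / exp (2 * L * T)"
      have d: "d > 0" using e by (simp add: d_def)
      have "\<forall>\<^sub>F n in sequentially. \<forall>y\<in>X. \<forall>s\<in>{0..T}. dist (U n y s) (u y s) < d"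
        using \<open>finite X\<close>
        by (rule eventually_ball_finite) (use u d in \<open>auto simp: uniform_limit_iff\<close>)
      then obtain N where N: "\<And>n y s. n \<ge> N \<Longrightarrow> y \<in> X \<Longrightarrow> s \<in> {0..T} \<Longrightarrow> \<bar>U n y s - u y s\<bar> < d"
        unfolding eventually_sequentially dist_real_def by blast
      have "norm (\<Phi> (U n) x t - \<Phi> u x t) < e" if "n \<ge> N" for n
      proof -
        have "\<bar>U n y s - u y s\<bar> \<le> d * exp (2 * L * s)" if "y \<in> X" "s \<in> {0..T}" for y s
        proof -
          have "d * 1 \<le> d * exp (2 * L * s)"
            using that d L by (intro mult_left_mono) auto
          with N[OF \<open>n \<ge> N\<close> that] show ?thesis by linarith
        qed
        then have "\<bar>\<Phi> (U n) x t - \<Phi> u x t\<bar> \<le> d / 2 * exp (2 * L * t)"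
          by (intro contraction x t U_cont u_cont)
        also have "\<dots> \<le> d / 2 * exp (2 * L * T)"
          using d t L by (intro mult_left_mono) auto
        also have "\<dots> < e" using e by (simp add: d_def)
        finally show ?thesis by simp
      qed
      then show "\<exists>no. \<forall>n\<ge>no. norm (\<Phi> (U n) x t - \<Phi> u x t) < e" by blast
    qed
    then show "(\<lambda>n. U (Suc n) x t) \<longlonglongrightarrow> \<Phi> u x t" by (simp add: U_Suc)
  qed
  \<comment> \<open>The witness is \<open>\<Phi> u\<close> instead of \<open>u\<close>: it has the
    right initial value by construction, even if \<open>{0..T}\<close> is empty, and
    \<open>\<Phi>_deriv\<close> gives its derivative. Both functions agree on \<open>X\<close> and
    \<open>{0..T}\<close>, so the Lipschitz bound with \<open>c = 0\<close> exchanges them inside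
    \<open>F\<close>.\<close>
  show thesis
  proof
    show "\<Phi> u x 0 = u0 x" for x by (simp add: \<Phi>_def)
    show "(\<Phi> u x has_real_derivative F (\<lambda>y. \<Phi> u y t) x) (at t within {0..T})"
      if "x \<in> X" "t \<in> {0..T}" for x t
    proof -
      have "\<bar>F (\<lambda>y. u y t) x - F (\<lambda>y. \<Phi> u y t) x\<bar> \<le> L * 0"
        using that fixpoint by (intro lip) auto
      then show ?thesis using \<Phi>_deriv[of x u t] that u_cont by simp
    qed
  qed
qed

subsection \<open>Semicontinuity\<close>

lemma usc_on_subset: "usc_on S f \<Longrightarrow> S' \<subseteq> S \<Longrightarrow> usc_on S' f"
  unfolding usc_on_def using filter_leD[OF at_le] by blast

lemma usc_on_diff_continuous:
  assumes "usc_on S f" "continuous_on S h"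
  shows "usc_on S (\<lambda>z. f z - h z)"
  unfolding usc_on_def
proof (intro ballI allI impI)
  fix z c assume z: "z \<in> S" and c: "f z - h z < c"
  define e where "e = (c - (f z - h z)) / 2"
  have e: "e > 0" using c by (simp add: e_def)
  have "\<forall>\<^sub>F w in at z within S. f w < f z + e"
    using assms(1) z e unfolding usc_on_def by simp
  moreover have "\<forall>\<^sub>F w in at z within S. h z - e < h w"
    using assms(2) z e unfolding continuous_on_def by (intro order_tendstoD) auto
  ultimately show "\<forall>\<^sub>F w in at z within S. f w - h w < c"
    by eventually_elim (simp add: e_def field_simps)
qed

lemma continuous_on_imp_usc_on:
  fixes f :: "'b::topological_space \<Rightarrow> real"
  assumes "continuous_on S f" shows "usc_on S f"
  unfolding usc_on_def using assms unfolding continuous_on_def by (blast intro: order_tendstoD(2))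

lemma continuous_on_imp_lsc_on:
  fixes f :: "'b::topological_space \<Rightarrow> real"
  assumes "continuous_on S f" shows "lsc_on S f"
  unfolding lsc_on_def using assms unfolding continuous_on_def by (blast intro: order_tendstoD(1))

lemma lsc_on_imp_usc_on_uminus:
  assumes "lsc_on S f" shows "usc_on S (\<lambda>z. - f z)"
  unfolding usc_on_def
proof (intro ballI allI impI)
  fix z c assume "z \<in> S" "- f z < c"
  then have "\<forall>\<^sub>F w in at z within S. - c < f w"
    using assms unfolding lsc_on_def by simp
  then show "\<forall>\<^sub>F w in at z within S. - f w < c" by eventually_elim simp
qed

text \<open>If no maximum were attained, each \<open>z\<close> would have some \<open>n z\<close>
  with a larger value, and \<open>f\<close> would stay below \<open>f (n z)\<close> near
  \<open>z\<close>. Finitely many of these neighbourhoods cover \<open>S\<close>, but the point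
  \<open>n m\<close> with the largest value among them can lie in none.\<close>

lemma usc_on_attains_sup:
  assumes "compact S" "S \<noteq> {}" "usc_on S f"
  obtains z where "z \<in> S" "\<And>w. w \<in> S \<Longrightarrow> f w \<le> f z"
proof -
  have "\<exists>z\<in>S. \<forall>w\<in>S. f w \<le> f z"
  proof (rule ccontr)
    assume "\<not> (\<exists>z\<in>S. \<forall>w\<in>S. f w \<le> f z)"
    then have "\<forall>z\<in>S. \<exists>z'\<in>S. f z < f z'" by (meson not_le)
    then obtain n where n: "\<And>z. z \<in> S \<Longrightarrow> n z \<in> S \<and> f z < f (n z)" by metis
    have "\<exists>U. open U \<and> z \<in> U \<and> (\<forall>w\<in>S \<inter> U. f w < f (n z))" if "z \<in> S" for z
    proof -
      have "\<forall>\<^sub>F w in at z within S. f w < f (n z)"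
        using assms(3) n that unfolding usc_on_def by blast
      then show ?thesis
        using n[OF that] unfolding eventually_at_topological by (metis IntD1 IntD2)
    qed
    then obtain U where U: "\<And>z. z \<in> S \<Longrightarrow> open (U z) \<and> z \<in> U z \<and> (\<forall>w\<in>S \<inter> U z. f w < f (n z))"
      by metis
    obtain C where C: "C \<subseteq> S" "finite C" "S \<subseteq> (\<Union>z\<in>C. U z)"
      using compactE_image[OF assms(1), of S U] U by blast
    with assms(2) have "C \<noteq> {}" by auto
    with C(2) obtain m where m: "m \<in> C" "\<And>z. z \<in> C \<Longrightarrow> f (n z) \<le> f (n m)"
      using obtains_MAX[of C "\<lambda>z. f (n z)"] Max_ge[of "(\<lambda>z. f (n z)) ` C"]
      by (metis finite_imageI imageI)
    have "n m \<in> S" using m(1) C(1) n by blast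
    with C(3) obtain z where "z \<in> C" "n m \<in> U z" by blast
    then have "f (n m) < f (n z)" using U C(1) \<open>n m \<in> S\<close> by blast
    with m(2)[OF \<open>z \<in> C\<close>] show False by simp
  qed
  with that show thesis by blast
qed

text \<open>The filter retains \<open>z\<close> itself, so isolated points of \<open>S\<close> are
  no exception. On a nontrivial filter, a limit determines both \<open>Limsup\<close> and
  \<open>Liminf\<close>.\<close>

lemma nhds_within_nontrivial: "z \<in> S \<Longrightarrow> inf (nhds z) (principal S) \<noteq> bot"
  by (auto simp: trivial_limit_def eventually_inf_principal dest: eventually_nhds_x_imp_x)

lemma envelope_eq_of_continuous:
  assumes "continuous_on S f" "z \<in> S"
  shows "usc_envelope S f z = f z" "lsc_envelope S f z = f z"
proof -
  let ?F = "inf (nhds z) (principal S)"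
  have "(f \<longlongrightarrow> f z) ?F"
  proof (rule topological_tendstoI)
    fix W assume W: "open W" "f z \<in> W"
    then have "\<forall>\<^sub>F w in at z within S. f w \<in> W"
      using assms unfolding continuous_on_def tendsto_def by blast
    then show "\<forall>\<^sub>F w in ?F. f w \<in> W"
      unfolding eventually_inf_principal eventually_at_filter
      by eventually_elim (use W in blast)
  qed
  then have lim: "((\<lambda>w. ereal (f w)) \<longlongrightarrow> ereal (f z)) ?F"
    by simp
  note nontrivial = nhds_within_nontrivial[OF assms(2)]
  show "usc_envelope S f z = f z"
    by (simp add: usc_envelope_def lim_imp_Limsup[OF nontrivial lim])
  show "lsc_envelope S f z = f z"
    by (simp add: lsc_envelope_def lim_imp_Liminf[OF nontrivial lim])
qed

text \<open>The point \<open>z\<close> belongs to every set of the filter, which places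
  \<open>f z\<close> between the two extended real limits. Local boundedness makes these limits
  finite; \<open>real_of_ereal\<close> would send an infinite one to 0.\<close>

lemma envelope_bounds:
  assumes "locally_bounded_on S f" "z \<in> S"
  shows "f z \<le> usc_envelope S f z" "lsc_envelope S f z \<le> f z"
proof -
  let ?F = "inf (nhds z) (principal S)" and ?f = "\<lambda>w. ereal (f w)"
  obtain U where U: "openin (top_of_set S) U" "z \<in> U" "bounded (f ` U)"
    using assms unfolding locally_bounded_on_def by blast
  then obtain B where B: "\<And>w. w \<in> U \<Longrightarrow> \<bar>f w\<bar> \<le> B" unfolding bounded_iff by auto
  obtain V where V: "open V" "U = S \<inter> V" using U(1) unfolding openin_open by blast
  have ev: "\<forall>\<^sub>F w in ?F. \<bar>f w\<bar> \<le> B"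
    using V U(2) B unfolding eventually_inf_principal eventually_nhds by blast
  have sup: "ereal (f z) \<le> Limsup ?F ?f"
    unfolding Limsup_def
    by (rule INF_greatest, rule SUP_upper2[where i = z])
      (use assms(2) in \<open>auto simp: eventually_inf_principal dest: eventually_nhds_x_imp_x\<close>)
  have inf: "Liminf ?F ?f \<le> ereal (f z)"
    unfolding Liminf_def
    by (rule SUP_least, rule INF_lower2[where i = z])
      (use assms(2) in \<open>auto simp: eventually_inf_principal dest: eventually_nhds_x_imp_x\<close>)
  have "Limsup ?F ?f \<le> ereal B"
    by (rule Limsup_bounded, rule eventually_mono[OF ev]) auto
  with sup show "f z \<le> usc_envelope S f z"
    unfolding usc_envelope_def by (cases "Limsup ?F ?f") auto
  have "ereal (- B) \<le> Liminf ?F ?f"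
    by (rule Liminf_bounded, rule eventually_mono[OF ev]) auto
  with inf show "lsc_envelope S f z \<le> f z"
    unfolding lsc_envelope_def by (cases "Liminf ?F ?f") auto
qed

text \<open>The penalty \<open>\<delta> / (T - t)\<close> keeps the point of contact away from the final time.\<close>

lemma penalized_contact_point:
  fixes v f :: "'a::topological_space \<times> real \<Rightarrow> real"
  assumes "finite X"
    and v: "usc_on (X \<times> {0..T}) v" and f: "continuous_on (X \<times> {0..T}) f"
    and x1: "x1 \<in> X" and t1: "t1 \<in> {0..<T}" and gt: "f (x1, t1) < v (x1, t1)"
  obtains x0 t0 \<delta> where "x0 \<in> X" "t0 \<in> {0..<T}" "\<delta> > 0" "f (x0, t0) < v (x0, t0)"
    and "\<And>x t. x \<in> X \<Longrightarrow> t \<in> {0..<T} \<Longrightarrow>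
      v (x, t) - f (x, t) - \<delta> / (T - t) \<le> v (x0, t0) - f (x0, t0) - \<delta> / (T - t0)"
proof -
  let ?d = "\<lambda>z. v z - f z"
  define \<alpha> where "\<alpha> = ?d (x1, t1)"
  have \<alpha>: "\<alpha> > 0" using gt by (simp add: \<alpha>_def)
  have S: "compact (X \<times> {0..T})" "X \<times> {0..T} \<noteq> {}"
    using \<open>finite X\<close> x1 t1 by (auto intro: compact_Times finite_imp_compact)
  obtain zm where "\<And>w. w \<in> X \<times> {0..T} \<Longrightarrow> ?d w \<le> ?d zm"
    using usc_on_attains_sup[OF S usc_on_diff_continuous[OF v f]] by metis
  then obtain B where B: "\<And>w. w \<in> X \<times> {0..T} \<Longrightarrow> ?d w \<le> B" by blast
  have "B > 0" using B[of "(x1, t1)"] x1 t1 \<alpha> by (auto simp: \<alpha>_def)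
  \<comment> \<open>With this size the penalty at \<open>t1\<close> is exactly
    \<open>\<alpha> / 2\<close>, so half of the positive gap survives there.\<close>
  define \<delta> where "\<delta> = \<alpha> * (T - t1) / 2"
  have \<delta>: "\<delta> > 0" using \<alpha> t1 by (simp add: \<delta>_def)
  \<comment> \<open>From time \<open>T'\<close> on, the penalty is at least \<open>B\<close>, and
    the penalized difference is at most 0. A maximum over the compact set
    \<open>X \<times> {0..T'}\<close> is therefore one over all times before
    \<open>T\<close>.\<close>
  define T' where "T' = T - \<delta> / B"
  have "T' < T" using \<delta> \<open>B > 0\<close> by (simp add: T'_def)
  define p where "p z = ?d z - \<delta> / (T - snd z)" for z
  have p1: "p (x1, t1) = \<alpha> / 2"
    using t1 by (simp add: p_def \<alpha>_def[symmetric] \<delta>_def field_simps)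
  have late: "p (x, t) \<le> 0" if "x \<in> X" "t \<in> {T'..<T}" "t \<ge> 0" for x t
  proof -
    have "B \<le> \<delta> / (T - t)" using that \<open>B > 0\<close> by (simp add: T'_def field_simps)
    with B[of "(x, t)"] that show ?thesis by (simp add: p_def)
  qed
  have "t1 < T'"
  proof (rule ccontr)
    assume "\<not> t1 < T'"
    then have "p (x1, t1) \<le> 0" using late x1 t1 by simp
    with p1 \<alpha> show False by simp
  qed
  have K: "compact (X \<times> {0..T'})" "X \<times> {0..T'} \<noteq> {}"
    using \<open>finite X\<close> x1 t1 \<open>t1 < T'\<close> by (auto intro: compact_Times finite_imp_compact)
  have sub: "X \<times> {0..T'} \<subseteq> X \<times> {0..T}" using \<open>T' < T\<close> by auto
  have "usc_on (X \<times> {0..T'}) p"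
    unfolding p_def
    by (intro usc_on_diff_continuous usc_on_subset[OF v sub] continuous_on_subset[OF f sub]
        continuous_intros) (use \<open>T' < T\<close> in auto)
  then obtain z0 where z0: "z0 \<in> X \<times> {0..T'}" "\<And>w. w \<in> X \<times> {0..T'} \<Longrightarrow> p w \<le> p z0"
    using usc_on_attains_sup[OF K] by metis
  obtain x0 t0 where [simp]: "z0 = (x0, t0)" by force
  have p0: "p z0 \<ge> \<alpha> / 2" using z0(2)[of "(x1, t1)"] p1 x1 t1 \<open>t1 < T'\<close> by auto
  have max: "p (x, t) \<le> p z0" if "x \<in> X" "t \<in> {0..<T}" for x t
  proof (cases "t \<le> T'")
    case True
    then show ?thesis using z0(2) that by simp
  next
    case False
    then have "p (x, t) \<le> 0" using late that by simp
    with p0 \<alpha> show ?thesis by linarith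
  qed
  have "\<delta> / (T - t0) > 0" using \<delta> z0(1) \<open>T' < T\<close> by simp
  then have "f (x0, t0) < v (x0, t0)" using p0 \<alpha> by (simp add: p_def)
  with that[of x0 t0 \<delta>] show thesis
    using z0(1) \<open>T' < T\<close> \<delta> max by (simp add: p_def)
qed

subsection \<open>The non-local equation on a finite set\<close>

text \<open>Points are closed in a T1 space, so the slices \<open>{x} \<times> S\<close> form a
  finite closed cover, along which continuity glues.\<close>

lemma continuous_on_finite_Times:
  fixes u :: "'a::t1_space \<Rightarrow> 'b::topological_space \<Rightarrow> 'c::topological_space"
  assumes "finite X" "closed S" "\<And>x. x \<in> X \<Longrightarrow> continuous_on S (u x)"
  shows "continuous_on (X \<times> S) (\<lambda>(x, t). u x t)"
proof -
  have "continuous_on (\<Union>x\<in>X. {x} \<times> S) (\<lambda>(x, t). u x t)"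
  proof (rule continuous_on_closed_Union)
    fix x assume "x \<in> X"
    then have "continuous_on ({x} \<times> S) (\<lambda>z. u x (snd z))"
      by (intro continuous_on_compose2[OF assms(3)] continuous_on_snd continuous_on_id) auto
    then show "continuous_on ({x} \<times> S) (\<lambda>(x, t). u x t)"
      by (rule continuous_on_cong[THEN iffD1, rotated -1]) auto
  qed (use assms in \<open>auto intro: closed_Times\<close>)
  moreover have "(\<Union>x\<in>X. {x} \<times> S) = X \<times> S" by auto
  ultimately show ?thesis by simp
qed

locale finite_eikonal_scheme =
  fixes X \<Gamma>t :: "'a::t2_space set" and T \<epsilon> :: real and \<eta> :: "real \<Rightarrow> real"
    and dt :: "'a \<Rightarrow> 'a \<Rightarrow> real" and Pt f0\<epsilon> :: "'a \<Rightarrow> real"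
  assumes finite_X: "finite X" and \<Gamma>t_subset: "\<Gamma>t \<subseteq> X" and T_pos: "T > 0" and \<epsilon>_pos: "\<epsilon> > 0"
    and dt_nonneg: "\<And>x y. x \<in> X \<Longrightarrow> y \<in> X \<Longrightarrow> dt x y \<ge> 0"
    and \<eta>_nonneg: "\<And>s. s \<ge> 0 \<Longrightarrow> \<eta> s \<ge> 0" and C_eta_pos: "C_eta \<eta> > 0"
begin

definition weight :: "'a \<Rightarrow> 'a \<Rightarrow> real" where
  "weight x y = real_of_ereal (1 / (ereal \<epsilon> * C_eta \<eta>)) * \<eta> (dt x y / \<epsilon>)"

text \<open>The non-local gradient with time frozen, as a function of the spatial values alone; in
  this form it is the right-hand side of an autonomous system.\<close>

definition hamiltonian :: "('a \<Rightarrow> real) \<Rightarrow> 'a \<Rightarrow> real" where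
  "hamiltonian u x = Max ((\<lambda>y. weight x y * (u x - u y)) ` X)"

lemma nl_grad_minus_eq: "nl_grad_minus X \<epsilon> \<eta> dt u x t = hamiltonian (\<lambda>y. u (y, t)) x"
  by (simp add: nl_grad_minus_def hamiltonian_def weight_def)

lemma weight_nonneg: "x \<in> X \<Longrightarrow> y \<in> X \<Longrightarrow> weight x y \<ge> 0"
proof -
  assume "x \<in> X" "y \<in> X"
  then have "\<eta> (dt x y / \<epsilon>) \<ge> 0" using dt_nonneg \<eta>_nonneg \<epsilon>_pos by simp
  \<comment> \<open>An infinite \<open>C_eta \<eta>\<close> is allowed; the quotient is then
    0.\<close>
  moreover have "1 / (ereal \<epsilon> * C_eta \<eta>) \<ge> 0"
    using \<epsilon>_pos C_eta_pos by (cases "C_eta \<eta>") auto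
  ultimately show ?thesis unfolding weight_def by (intro mult_nonneg_nonneg real_of_ereal_pos)
qed

lemma compact_domain: "compact (X \<times> {0..T})"
  by (intro compact_Times finite_imp_compact[OF finite_X] compact_Icc)

text \<open>An additive error common to all terms passes through the maximum. Error 0 yields
  monotonicity, and a positive error yields the Lipschitz estimate.\<close>

lemma hamiltonian_le:
  assumes "x \<in> X" "\<And>y. y \<in> X \<Longrightarrow> weight x y * (u x - u y) \<le> weight x y * (v x - v y) + c"
  shows "hamiltonian u x \<le> hamiltonian v x + c"
proof -
  have "weight x y * (u x - u y) \<le> hamiltonian v x + c" if "y \<in> X" for y
  proof -
    have "weight x y * (v x - v y) \<le> hamiltonian v x"
      unfolding hamiltonian_def using finite_X that by (intro Max_ge) auto
    with assms(2)[OF that] show ?thesis by linarith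
  qed
  then show ?thesis
    unfolding hamiltonian_def[of u] using finite_X assms(1) by (subst Max_le_iff) auto
qed

text \<open>Non-negative weights preserve inequalities between differences. This monotonicity is the
  ellipticity on which comparison rests.\<close>

lemma hamiltonian_mono:
  assumes "x \<in> X" "\<And>y. y \<in> X \<Longrightarrow> u x - u y \<le> v x - v y"
  shows "hamiltonian u x \<le> hamiltonian v x"
  using hamiltonian_le[of x u v 0] assms by (simp add: mult_left_mono weight_nonneg)

text \<open>The factor 2 accounts for the two values in \<open>u x - u y\<close>, the double sum
  dominates every single weight, and the summand 1 keeps the constant positive when all weights
  vanish.\<close>

definition lip_const :: real where
  "lip_const = 2 * (1 + (\<Sum>x\<in>X. \<Sum>y\<in>X. weight x y))"

lemma lip_const_pos: "lip_const > 0"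
  unfolding lip_const_def by (smt (verit) sum_nonneg weight_nonneg)

lemma weight_le_lip_const:
  assumes "x \<in> X" "y \<in> X" shows "2 * weight x y \<le> lip_const"
proof -
  have "weight x y \<le> (\<Sum>y\<in>X. weight x y)"
    using assms finite_X weight_nonneg by (intro member_le_sum) auto
  also have "\<dots> \<le> (\<Sum>x\<in>X. \<Sum>y\<in>X. weight x y)"
    using assms finite_X weight_nonneg
    by (intro member_le_sum[where f = "\<lambda>x. \<Sum>y\<in>X. weight x y"] sum_nonneg) auto
  finally show ?thesis by (simp add: lip_const_def)
qed

lemma hamiltonian_lipschitz:
  assumes "x \<in> X" and uv: "\<And>y. y \<in> X \<Longrightarrow> \<bar>u y - v y\<bar> \<le> c"
  shows "\<bar>hamiltonian u x - hamiltonian v x\<bar> \<le> lip_const * c"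
proof -
  have *: "hamiltonian u x \<le> hamiltonian v x + lip_const * c"
    if "\<And>y. y \<in> X \<Longrightarrow> \<bar>u y - v y\<bar> \<le> c" for u v
  proof (rule hamiltonian_le[OF \<open>x \<in> X\<close>])
    fix y assume "y \<in> X"
    have "c \<ge> 0" using that[OF \<open>x \<in> X\<close>] by linarith
    have "weight x y * ((u x - u y) - (v x - v y)) \<le> weight x y * (2 * c)"
      using that[OF \<open>x \<in> X\<close>] that[OF \<open>y \<in> X\<close>] \<open>x \<in> X\<close> \<open>y \<in> X\<close>
      by (intro mult_left_mono weight_nonneg) auto
    also have "\<dots> = (2 * weight x y) * c" by simp
    also have "\<dots> \<le> lip_const * c"
      using \<open>x \<in> X\<close> \<open>y \<in> X\<close> \<open>c \<ge> 0\<close> by (intro mult_right_mono weight_le_lip_const)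
    finally show "weight x y * (u x - u y) \<le> weight x y * (v x - v y) + lip_const * c"
      by (simp add: algebra_simps)
  qed
  have "\<bar>v y - u y\<bar> \<le> c" if "y \<in> X" for y
    using uv[OF that] by (simp add: abs_minus_commute)
  with *[of u v] *[of v u] uv show ?thesis by (simp add: abs_le_iff)
qed

section \<open>Classical solutions: existence and use as test functions\<close>

definition classical_solution :: "('a \<times> real \<Rightarrow> real) \<Rightarrow> bool" where
  "classical_solution u \<longleftrightarrow>
     continuous_on (X \<times> {0..T}) u \<and>
     (\<forall>(x, t)\<in>parabolic_boundary X \<Gamma>t T. u (x, t) = f0\<epsilon> x) \<and>
     (\<forall>x\<in>X - \<Gamma>t. \<forall>t\<in>{0<..<T}.
        ((\<lambda>s. u (x, s)) has_real_derivative Pt x - hamiltonian (\<lambda>y. u (y, t)) x) (at t))"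

lemma classical_solution_exists: "\<exists>u. classical_solution u"
proof -
  \<comment> \<open>A zero right-hand side on \<open>\<Gamma>t\<close> freezes these values at their
    initial data, so the lateral boundary condition becomes part of one initial value problem on all
    of \<open>X\<close>.\<close>
  define F where "F u x = (if x \<in> \<Gamma>t then 0 else Pt x - hamiltonian u x)" for u x
  have "\<bar>F u x - F v x\<bar> \<le> lip_const * c"
    if "x \<in> X" "\<And>y. y \<in> X \<Longrightarrow> \<bar>u y - v y\<bar> \<le> c" for u v c x
  proof -
    have "c \<ge> 0" using that(2)[OF that(1)] by linarith
    then have "0 \<le> lip_const * c" using lip_const_pos by simp
    with hamiltonian_lipschitz[OF that] show ?thesis by (simp add: F_def abs_minus_commute)
  qed
  then obtain u where u0: "\<And>x. x \<in> X \<Longrightarrow> u x 0 = f0\<epsilon> x"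
    and u': "\<And>x t. x \<in> X \<Longrightarrow> t \<in> {0..T} \<Longrightarrow>
      (u x has_real_derivative F (\<lambda>y. u y t) x) (at t within {0..T})"
    using picard_lindelof_finite_system[OF finite_X lip_const_pos, of F f0\<epsilon> T] by blast
  have "continuous_on {0..T} (u x)" if "x \<in> X" for x
    by (rule DERIV_continuous_on, rule u'[OF that])
  then have "continuous_on (X \<times> {0..T}) (\<lambda>(x, t). u x t)"
    using finite_X by (intro continuous_on_finite_Times) auto
  moreover have "u x t = f0\<epsilon> x" if "x \<in> \<Gamma>t" "t \<in> {0..T}" for x t
  proof -
    have "x \<in> X" using that \<Gamma>t_subset by blast
    then have "(u x has_real_derivative 0) (at s within {0..T})" if "s \<in> {0..T}" for s
      using u'[OF \<open>x \<in> X\<close> that] \<open>x \<in> \<Gamma>t\<close> by (simp add: F_def)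
    then obtain k where "\<And>s. s \<in> {0..T} \<Longrightarrow> u x s = k"
      using has_field_derivative_zero_constant[of "{0..T}" "u x"] by auto
    then show ?thesis using u0[OF \<open>x \<in> X\<close>] that T_pos by auto
  qed
  moreover have "(u x has_real_derivative Pt x - hamiltonian (\<lambda>y. u y t) x) (at t)"
    if "x \<in> X - \<Gamma>t" "t \<in> {0<..<T}" for x t
  proof -
    have "(u x has_real_derivative F (\<lambda>y. u y t) x) (at t within {0<..<T})"
      using u'[of x t] that by (auto intro: has_field_derivative_subset)
    then show ?thesis
      using that at_within_open[OF that(2) open_greaterThanLessThan] by (simp add: F_def)
  qed
  ultimately have "classical_solution (\<lambda>(x, t). u x t)"
    unfolding classical_solution_def parabolic_boundary_def using u0 by auto
  then show ?thesis by blast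
qed

lemma continuous_on_slice:
  "continuous_on (X \<times> {0..T}) u \<Longrightarrow> x \<in> X \<Longrightarrow> continuous_on {0..T} (\<lambda>t. u (x, t))"
  by (rule continuous_on_compose2[of "X \<times> {0..T}" u]) (auto intro!: continuous_intros)

text \<open>The comparison arguments test with the classical solution plus a penalty; a positive
  \<open>k\<close> serves sub-solutions and a negative one super-solutions. The derivative is
  continuous because \<open>hamiltonian\<close> is Lipschitz in the continuous values of
  \<open>u\<close>.\<close>

lemma classical_solution_test_function:
  fixes k :: real
  assumes "classical_solution u" and x: "x \<in> X - \<Gamma>t"
  defines "\<phi> \<equiv> \<lambda>t. u (x, t) + k / (T - t)"
  shows "\<phi> C1_differentiable_on {0<..<T}"
    and "t \<in> {0<..<T} \<Longrightarrow> deriv \<phi> t = Pt x - hamiltonian (\<lambda>y. u (y, t)) x + k / (T - t)\<^sup>2"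
proof -
  let ?D = "\<lambda>t. Pt x - hamiltonian (\<lambda>y. u (y, t)) x + k / (T - t)\<^sup>2"
  have \<phi>': "(\<phi> has_real_derivative ?D t) (at t)" if "t \<in> {0<..<T}" for t
  proof -
    have "((\<lambda>s. u (x, s)) has_real_derivative Pt x - hamiltonian (\<lambda>y. u (y, t)) x) (at t)"
      using assms(1) x that unfolding classical_solution_def by blast
    moreover have "((\<lambda>t. k / (T - t)) has_real_derivative k / (T - t)\<^sup>2) (at t)"
      using that by (auto intro!: derivative_eq_intros simp: power2_eq_square)
    ultimately show ?thesis unfolding \<phi>_def by (rule DERIV_add)
  qed
  then show "t \<in> {0<..<T} \<Longrightarrow> deriv \<phi> t = ?D t" by (rule DERIV_imp_deriv)
  have "continuous_on {0<..<T} (\<lambda>t. u (y, t))" if "y \<in> X" for y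
    using assms(1) that unfolding classical_solution_def
    by (auto intro: continuous_on_subset[OF continuous_on_slice])
  then have "continuous_on {0<..<T} (\<lambda>t. hamiltonian (\<lambda>y. u (y, t)) x)"
    using x by (intro continuous_on_lipschitz_field[OF finite_X hamiltonian_lipschitz]) auto
  then have "continuous_on {0<..<T} ?D"
    by (intro continuous_intros) auto
  then show "\<phi> C1_differentiable_on {0<..<T}"
    unfolding C1_differentiable_on_def
    using \<phi>' by (intro exI[of _ ?D]) (auto simp: has_real_derivative_iff_has_vector_derivative)
qed

section \<open>Comparison with sub- and super-solutions\<close>

text \<open>At a contact point of the penalized difference, the sub-solution inequality and the
  equation for \<open>u\<close> would force \<open>\<delta> / (T - t0)\<^sup>2 \<le> 0\<close>. Time
  \<open>T\<close> is left out since neither the data nor the equation bounds \<open>v\<close> from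
  above there.\<close>

lemma subsolution_le_classical:
  assumes v: "visc_subsolution X \<Gamma>t T \<epsilon> \<eta> dt Pt f0\<epsilon> v" and u: "classical_solution u"
    and x: "x \<in> X" and t: "t \<in> {0..<T}"
  shows "v (x, t) \<le> u (x, t)"
proof (rule ccontr)
  assume "\<not> v (x, t) \<le> u (x, t)"
  then have "u (x, t) < v (x, t)" by simp
  moreover have "usc_on (X \<times> {0..T}) v" "continuous_on (X \<times> {0..T}) u"
    using u v unfolding classical_solution_def visc_subsolution_def by auto
  ultimately obtain x0 t0 \<delta> where x0: "x0 \<in> X" and t0: "t0 \<in> {0..<T}" and \<delta>: "\<delta> > 0"
    and gt: "u (x0, t0) < v (x0, t0)"
    and max: "\<And>x t. x \<in> X \<Longrightarrow> t \<in> {0..<T} \<Longrightarrow>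
      v (x, t) - u (x, t) - \<delta> / (T - t) \<le> v (x0, t0) - u (x0, t0) - \<delta> / (T - t0)"
    using penalized_contact_point[OF finite_X _ _ x t, of v u] by blast
  \<comment> \<open>On the parabolic boundary \<open>v\<close> is at most the datum, which equals
    \<open>u\<close>, contrary to \<open>gt\<close>.\<close>
  have "(x0, t0) \<notin> parabolic_boundary X \<Gamma>t T"
    using u v gt unfolding classical_solution_def visc_subsolution_def by fastforce
  with x0 t0 have x0': "x0 \<in> X - \<Gamma>t" and t0': "t0 \<in> {0<..<T}"
    unfolding parabolic_boundary_def by (auto simp: less_le)
  define \<phi> where "\<phi> t = u (x0, t) + \<delta> / (T - t)" for t
  note \<phi> = classical_solution_test_function[OF u x0', where k = \<delta>, folded \<phi>_def]
  have "\<forall>\<^sub>F t in nhds t0. t \<in> {0<..<T}"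
    using t0' by (intro eventually_nhds_in_open) auto
  then have "\<forall>\<^sub>F t in nhds t0. v (x0, t) - \<phi> t \<le> v (x0, t0) - \<phi> t0"
  proof eventually_elim
    case (elim t)
    then show ?case using max[OF x0, of t] by (simp add: \<phi>_def)
  qed
  then have "deriv \<phi> t0 + hamiltonian (\<lambda>y. v (y, t0)) x0 \<le> Pt x0"
    using v x0' t0' \<phi>(1) unfolding visc_subsolution_def nl_grad_minus_eq by blast
  \<comment> \<open>At the common time \<open>t0\<close> the penalties cancel in \<open>max\<close>,
    leaving \<open>u x0 - u y \<le> v x0 - v y\<close> for the values at that time.\<close>
  moreover have "hamiltonian (\<lambda>y. u (y, t0)) x0 \<le> hamiltonian (\<lambda>y. v (y, t0)) x0"
    by (rule hamiltonian_mono[OF x0]) (use max[of _ t0] t0 in force)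
  moreover have "\<delta> / (T - t0)\<^sup>2 > 0" using \<delta> t0 by simp
  ultimately show False using \<phi>(2)[OF t0'] by linarith
qed

text \<open>The non-local gradient is not odd, so negation does not reduce this to the case of
  sub-solutions. Only the contact point is found for \<open>- v\<close> and \<open>- u\<close>; the
  test function then carries the penalty with the opposite sign.\<close>

lemma supersolution_ge_classical:
  assumes v: "visc_supersolution X \<Gamma>t T \<epsilon> \<eta> dt Pt f0\<epsilon> v" and u: "classical_solution u"
    and x: "x \<in> X" and t: "t \<in> {0..<T}"
  shows "u (x, t) \<le> v (x, t)"
proof (rule ccontr)
  assume "\<not> u (x, t) \<le> v (x, t)"
  then have "- u (x, t) < - v (x, t)" by simp
  moreover have "usc_on (X \<times> {0..T}) (\<lambda>z. - v z)" "continuous_on (X \<times> {0..T}) (\<lambda>z. - u z)"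
    using u v unfolding classical_solution_def visc_supersolution_def
    by (auto intro: lsc_on_imp_usc_on_uminus continuous_on_minus)
  ultimately obtain x0 t0 \<delta> where x0: "x0 \<in> X" and t0: "t0 \<in> {0..<T}" and \<delta>: "\<delta> > 0"
    and gt: "- u (x0, t0) < - v (x0, t0)"
    and max: "\<And>x t. x \<in> X \<Longrightarrow> t \<in> {0..<T} \<Longrightarrow>
      - v (x, t) - - u (x, t) - \<delta> / (T - t) \<le> - v (x0, t0) - - u (x0, t0) - \<delta> / (T - t0)"
    using penalized_contact_point[OF finite_X _ _ x t, of "\<lambda>z. - v z" "\<lambda>z. - u z"] by blast
  have "(x0, t0) \<notin> parabolic_boundary X \<Gamma>t T"
    using u v gt unfolding classical_solution_def visc_supersolution_def by fastforce
  with x0 t0 have x0': "x0 \<in> X - \<Gamma>t" and t0': "t0 \<in> {0<..<T}"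
    unfolding parabolic_boundary_def by (auto simp: less_le)
  define \<phi> where "\<phi> t = u (x0, t) + (- \<delta>) / (T - t)" for t
  note \<phi> = classical_solution_test_function[OF u x0', where k = "- \<delta>", folded \<phi>_def]
  have "\<forall>\<^sub>F t in nhds t0. t \<in> {0<..<T}"
    using t0' by (intro eventually_nhds_in_open) auto
  then have "\<forall>\<^sub>F t in nhds t0. v (x0, t0) - \<phi> t0 \<le> v (x0, t) - \<phi> t"
  proof eventually_elim
    case (elim t)
    then show ?case using max[OF x0, of t] by (simp add: \<phi>_def)
  qed
  then have "Pt x0 \<le> deriv \<phi> t0 + hamiltonian (\<lambda>y. v (y, t0)) x0"
    using v x0' t0' \<phi>(1) unfolding visc_supersolution_def nl_grad_minus_eq by blast
  moreover have "hamiltonian (\<lambda>y. v (y, t0)) x0 \<le> hamiltonian (\<lambda>y. u (y, t0)) x0"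
    by (rule hamiltonian_mono[OF x0]) (use max[of _ t0] t0 in force)
  moreover have "- \<delta> / (T - t0)\<^sup>2 < 0" using \<delta> t0 by simp
  ultimately show False using \<phi>(2)[OF t0'] by linarith
qed

section \<open>Classical solutions are viscosity solutions\<close>

text \<open>The first-order condition at a local extremum of \<open>w - \<phi>\<close>, for contact
  from either side.\<close>

lemma deriv_eq_at_contact:
  fixes \<phi> w :: "real \<Rightarrow> real"
  assumes \<phi>: "\<phi> C1_differentiable_on {0<..<T}" and t0: "t0 \<in> {0<..<T}"
    and w: "(w has_real_derivative d) (at t0)"
    and "(\<forall>\<^sub>F t in nhds t0. w t - \<phi> t \<le> w t0 - \<phi> t0) \<or> (\<forall>\<^sub>F t in nhds t0. w t0 - \<phi> t0 \<le> w t - \<phi> t)"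
  shows "deriv \<phi> t0 = d"
proof -
  have "\<phi> differentiable at t0" using \<phi> t0 unfolding C1_differentiable_on_eq by blast
  then have "(\<phi> has_real_derivative deriv \<phi> t0) (at t0)"
    by (simp add: DERIV_deriv_iff_real_differentiable)
  from DERIV_diff[OF w this]
  have D: "((\<lambda>t. w t - \<phi> t) has_real_derivative d - deriv \<phi> t0) (at t0)" .
  from assms(4) have "d - deriv \<phi> t0 = 0"
  proof
    assume "\<forall>\<^sub>F t in nhds t0. w t - \<phi> t \<le> w t0 - \<phi> t0"
    then obtain e where "e > 0" "\<forall>t. dist t t0 < e \<longrightarrow> w t - \<phi> t \<le> w t0 - \<phi> t0"
      unfolding eventually_nhds_metric by blast
    then show ?thesis
      by (intro DERIV_local_max[OF D, of e]) (auto simp: dist_real_def abs_minus_commute)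
  next
    assume "\<forall>\<^sub>F t in nhds t0. w t0 - \<phi> t0 \<le> w t - \<phi> t"
    then obtain e where "e > 0" "\<forall>t. dist t t0 < e \<longrightarrow> w t0 - \<phi> t0 \<le> w t - \<phi> t"
      unfolding eventually_nhds_metric by blast
    then show ?thesis
      by (intro DERIV_local_min[OF D, of e]) (auto simp: dist_real_def abs_minus_commute)
  qed
  then show ?thesis by simp
qed

text \<open>By continuity both envelopes coincide with \<open>u\<close> on the domain, and every
  test function in contact has the slope that the differential equation prescribes, so both
  viscosity inequalities hold.\<close>

lemma classical_imp_visc_solution:
  assumes u: "classical_solution u"
  shows "visc_solution X \<Gamma>t T \<epsilon> \<eta> dt Pt f0\<epsilon> u"
proof -
  let ?S = "X \<times> {0..T}"
  have cont: "continuous_on ?S u" using u unfolding classical_solution_def by blast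
  have "bounded (u ` ?S)"
    by (intro compact_imp_bounded compact_continuous_image cont compact_domain)
  then have lb: "locally_bounded_on ?S u"
    unfolding locally_bounded_on_def using openin_subtopology_self by blast
  have bdry_sub: "parabolic_boundary X \<Gamma>t T \<subseteq> ?S"
    using \<Gamma>t_subset T_pos unfolding parabolic_boundary_def by auto
  have bdry: "case z of (x, t) \<Rightarrow> u (x, t) = f0\<epsilon> x" if "z \<in> parabolic_boundary X \<Gamma>t T" for z
    using u that unfolding classical_solution_def by blast
  note env = envelope_eq_of_continuous[OF cont]
  have lsc: "lsc_on ?S u"
    using cont by (rule continuous_on_imp_lsc_on)
  have usc: "usc_on ?S u" using cont by (rule continuous_on_imp_usc_on)
  have ode: "((\<lambda>s. u (x, s)) has_real_derivative Pt x - hamiltonian (\<lambda>y. u (y, t)) x) (at t)"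
    if "x \<in> X - \<Gamma>t" "t \<in> {0<..<T}" for x t
    using u that unfolding classical_solution_def by blast
  \<comment> \<open>The envelopes are known to equal \<open>u\<close> only for times in
    \<open>{0..T}\<close>, whereas the extremum condition concerns a full neighbourhood of
    \<open>t0\<close>.\<close>
  have near: "\<forall>\<^sub>F t in nhds t0. t \<in> {0..T}" if "t0 \<in> {0<..<T}" for t0
    by (rule eventually_mono[OF eventually_nhds_in_open[OF open_greaterThanLessThan that]]) auto
  show ?thesis
    unfolding visc_solution_def
  proof (intro conjI lb)
    let ?u = "usc_envelope ?S u"
    have eq: "?u z = u z" if "z \<in> ?S" for z using env that by blast
    show "visc_subsolution X \<Gamma>t T \<epsilon> \<eta> dt Pt f0\<epsilon> ?u"
      unfolding visc_subsolution_def nl_grad_minus_eq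
    proof (intro conjI ballI allI impI)
      show "usc_on ?S ?u"
        using usc unfolding usc_on_def by (simp add: eventually_at_filter eq cong: imp_cong)
      show "case z of (x, t) \<Rightarrow> ?u (x, t) \<le> f0\<epsilon> x" if "z \<in> parabolic_boundary X \<Gamma>t T" for z
        using that bdry[OF that] eq[of z] bdry_sub by auto
      fix x0 \<phi> t0
      assume x0: "x0 \<in> X - \<Gamma>t" and \<phi>: "\<phi> C1_differentiable_on {0<..<T}" and t0: "t0 \<in> {0<..<T}"
        and "\<forall>\<^sub>F t in nhds t0. ?u (x0, t) - \<phi> t \<le> ?u (x0, t0) - \<phi> t0"
      from this(4) near[OF t0] have "\<forall>\<^sub>F t in nhds t0. u (x0, t) - \<phi> t \<le> u (x0, t0) - \<phi> t0"
        by eventually_elim (use x0 t0 eq in simp)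
      then have "deriv \<phi> t0 = Pt x0 - hamiltonian (\<lambda>y. u (y, t0)) x0"
        by (intro deriv_eq_at_contact[OF \<phi> t0 ode[OF x0 t0]] disjI1)
      moreover have "hamiltonian (\<lambda>y. ?u (y, t0)) x0 \<le> hamiltonian (\<lambda>y. u (y, t0)) x0"
        using x0 t0 eq by (intro hamiltonian_mono) auto
      ultimately show "deriv \<phi> t0 + hamiltonian (\<lambda>y. ?u (y, t0)) x0 \<le> Pt x0" by simp
    qed
  next
    let ?u = "lsc_envelope ?S u"
    have eq: "?u z = u z" if "z \<in> ?S" for z using env that by blast
    show "visc_supersolution X \<Gamma>t T \<epsilon> \<eta> dt Pt f0\<epsilon> ?u"
      unfolding visc_supersolution_def nl_grad_minus_eq
    proof (intro conjI ballI allI impI)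
      show "lsc_on ?S ?u"
        using lsc unfolding lsc_on_def by (simp add: eventually_at_filter eq cong: imp_cong)
      show "case z of (x, t) \<Rightarrow> f0\<epsilon> x \<le> ?u (x, t)" if "z \<in> parabolic_boundary X \<Gamma>t T" for z
        using that bdry[OF that] eq[of z] bdry_sub by auto
      fix x0 \<phi> t0
      assume x0: "x0 \<in> X - \<Gamma>t" and \<phi>: "\<phi> C1_differentiable_on {0<..<T}" and t0: "t0 \<in> {0<..<T}"
        and "\<forall>\<^sub>F t in nhds t0. ?u (x0, t0) - \<phi> t0 \<le> ?u (x0, t) - \<phi> t"
      from this(4) near[OF t0] have "\<forall>\<^sub>F t in nhds t0. u (x0, t0) - \<phi> t0 \<le> u (x0, t) - \<phi> t"
        by eventually_elim (use x0 t0 eq in simp)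
      then have "deriv \<phi> t0 = Pt x0 - hamiltonian (\<lambda>y. u (y, t0)) x0"
        by (intro deriv_eq_at_contact[OF \<phi> t0 ode[OF x0 t0]] disjI2)
      moreover have "hamiltonian (\<lambda>y. u (y, t0)) x0 \<le> hamiltonian (\<lambda>y. ?u (y, t0)) x0"
        using x0 t0 eq by (intro hamiltonian_mono) auto
      ultimately show "Pt x0 \<le> deriv \<phi> t0 + hamiltonian (\<lambda>y. ?u (y, t0)) x0" by simp
    qed
  qed
qed

text \<open>Comparison on both sides closes the chain: \<open>u\<close> is at most the lower
  envelope, then come \<open>h\<close> and the upper envelope, which is at most
  \<open>u\<close>.\<close>

lemma visc_solution_eq_classical:
  assumes h: "visc_solution X \<Gamma>t T \<epsilon> \<eta> dt Pt f0\<epsilon> h" and u: "classical_solution u"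
    and "x \<in> X" "t \<in> {0..<T}"
  shows "h (x, t) = u (x, t)"
proof -
  let ?S = "X \<times> {0..T}"
  have "(x, t) \<in> ?S" using assms by simp
  then have "h (x, t) \<le> usc_envelope ?S h (x, t)" "lsc_envelope ?S h (x, t) \<le> h (x, t)"
    using h envelope_bounds unfolding visc_solution_def by blast+
  moreover have "usc_envelope ?S h (x, t) \<le> u (x, t)" "u (x, t) \<le> lsc_envelope ?S h (x, t)"
    using assms subsolution_le_classical supersolution_ge_classical unfolding visc_solution_def by blast+
  ultimately show ?thesis by linarith
qed

end

section \<open>Extension to the final time and conclusion\<close>

lemma continuous_on_le_at_right_end:
  fixes f h :: "real \<Rightarrow> real"
  assumes "a < b" "continuous_on {a..b} f" "continuous_on {a..b} h"
    and "\<And>t. t \<in> {a..<b} \<Longrightarrow> f t \<le> h t" "t \<in> {a..b}"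
  shows "f t \<le> h t"
proof -
  have "closure {a..<b} = {a..b}" using \<open>a < b\<close> by simp
  then show ?thesis
    using continuous_le_on_closure[of "{a..<b}" "\<lambda>t. f t - h t" t 0] assms
    by (auto intro: continuous_on_diff)
qed

theorem proposition3p13:
  fixes M \<Gamma> Mt \<Gamma>t :: "'a::t2_space set"
    and \<A> :: "('a, 'e::euclidean_space) chart set"
    and g :: "('a, 'e) metric_field"
    and T \<epsilon> a r\<^sub>\<eta> :: real
    and P Pt f0 f0\<epsilon> \<psi>b :: "'a \<Rightarrow> real"
    and \<eta> :: "real \<Rightarrow> real"
    and dt :: "'a \<Rightarrow> 'a \<Rightarrow> real"
  assumes "T > 0" and "\<epsilon> > 0"
    and "riemannian_manifold M \<A> g" and "compact M" and "geodesically_strongly_convex M \<A> g"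
    and "finite Mt" and "Mt \<subseteq> M"
    and "closedin (top_of_set M) \<Gamma>" and "closedin (top_of_set Mt) \<Gamma>t"
    and "openin (top_of_set M) (M - \<Gamma>)" and "Mt - \<Gamma>t \<subseteq> M - \<Gamma>"
    and "P \<in> Lip (riem_dist M \<A> g) (M - \<Gamma>)" and "\<forall>x\<in>M - \<Gamma>. P x \<ge> 0"
    and "Pt \<in> Lip (riem_dist M \<A> g) (Mt - \<Gamma>t)" and "\<forall>x\<in>Mt - \<Gamma>t. Pt x \<ge> 0"
    and "f0 \<in> Lip (riem_dist M \<A> g) M" and "f0\<epsilon> \<in> Lip (riem_dist M \<A> g) Mt"
    and "\<forall>x\<in>Mt. \<forall>y\<in>Mt. dt x y \<ge> 0"
    and "\<forall>s\<ge>0. \<eta> s \<ge> 0"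
    and "r\<^sub>\<eta> > 0" and "closure {s. s \<ge> 0 \<and> \<eta> s \<noteq> 0} \<subseteq> {0..r\<^sub>\<eta>}"
    and "a \<in> {0<..<r\<^sub>\<eta>}" and "antimono_on {0..a} \<eta>" and "\<eta> a > 0"
    and "C_eta \<eta> > 0"
    and "\<psi>b \<in> Lip (riem_dist M \<A> g) M" and "\<forall>x\<in>\<Gamma>t. \<psi>b x = f0\<epsilon> x"
    and "visc_subsolution Mt \<Gamma>t T \<epsilon> \<eta> dt Pt f0\<epsilon> (\<lambda>(x, t). \<psi>b x)"
  shows "\<exists>f\<epsilon>. visc_solution Mt \<Gamma>t T \<epsilon> \<eta> dt Pt f0\<epsilon> f\<epsilon> \<and>
           continuous_on (Mt \<times> {0..T}) f\<epsilon> \<and>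
           (\<forall>h. visc_solution Mt \<Gamma>t T \<epsilon> \<eta> dt Pt f0\<epsilon> h \<longrightarrow>
              (\<forall>z\<in>Mt \<times> {0..<T}. h z = f\<epsilon> z) \<and>
              (continuous_on (Mt \<times> {0..T}) h \<longrightarrow> (\<forall>z\<in>Mt \<times> {0..T}. h z = f\<epsilon> z))) \<and>
           (\<exists>fbar\<in>Lip (riem_dist M \<A> g) Mt. \<forall>x\<in>Mt. \<forall>t\<in>{0..T}.
              \<psi>b x \<le> f\<epsilon> (x, t) \<and> f\<epsilon> (x, t) \<le> fbar x)"
proof -
  interpret finite_eikonal_scheme Mt \<Gamma>t T \<epsilon> \<eta> dt Pt f0\<epsilon>
    using assms closedin_subset[of "top_of_set Mt" \<Gamma>t] by unfold_locales auto
  obtain u where u: "classical_solution u" using classical_solution_exists by blast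
  then have cont: "continuous_on (Mt \<times> {0..T}) u" unfolding classical_solution_def by blast
  \<comment> \<open>No data are prescribed and no test is made at time \<open>T\<close>, so
    comparison gives equality only before \<open>T\<close>; continuity of \<open>h\<close> and
    \<open>u\<close> in time carries it to \<open>T\<close>.\<close>
  have unique: "h (x, t) = u (x, t)"
    if "visc_solution Mt \<Gamma>t T \<epsilon> \<eta> dt Pt f0\<epsilon> h" "continuous_on (Mt \<times> {0..T}) h"
      "x \<in> Mt" "t \<in> {0..T}" for h x t
  proof (rule antisym)
    note slices = continuous_on_slice[OF that(2,3)] continuous_on_slice[OF cont that(3)]
    show "h (x, t) \<le> u (x, t)"
      using visc_solution_eq_classical[OF that(1) u that(3)]
      by (intro continuous_on_le_at_right_end[OF T_pos slices(1,2) _ that(4)]) simp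
    show "u (x, t) \<le> h (x, t)"
      using visc_solution_eq_classical[OF that(1) u that(3)]
      by (intro continuous_on_le_at_right_end[OF T_pos slices(2,1) _ that(4)]) simp
  qed
  \<comment> \<open>The barrier is constant in time, so the comparison before \<open>T\<close>
    extends to \<open>T\<close> by continuity of \<open>u\<close> alone.\<close>
  have lower: "\<psi>b x \<le> u (x, t)" if "x \<in> Mt" "t \<in> {0..T}" for x t
    using subsolution_le_classical[OF assms(28) u that(1)]
    by (intro continuous_on_le_at_right_end[OF T_pos continuous_on_const
          continuous_on_slice[OF cont that(1)] _ that(2)]) simp
  have "bounded (u ` (Mt \<times> {0..T}))"
    by (intro compact_imp_bounded compact_continuous_image cont compact_domain)
  then obtain B where "\<forall>r\<in>u ` (Mt \<times> {0..T}). norm r \<le> B" unfolding bounded_iff by blast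
  then have upper: "u (x, t) \<le> B" if "x \<in> Mt" "t \<in> {0..T}" for x t
    using that by (force simp: abs_le_iff)
  have "(\<lambda>_. B) \<in> Lip (riem_dist M \<A> g) Mt" by (auto simp: Lip_def)
  then have bounds: "\<exists>fbar\<in>Lip (riem_dist M \<A> g) Mt. \<forall>x\<in>Mt. \<forall>t\<in>{0..T}.
      \<psi>b x \<le> u (x, t) \<and> u (x, t) \<le> fbar x"
    using lower upper by (intro bexI[of _ "\<lambda>_. B"]) auto
  show ?thesis
  proof (intro exI[of _ u] conjI allI impI)
    fix h assume h: "visc_solution Mt \<Gamma>t T \<epsilon> \<eta> dt Pt f0\<epsilon> h"
    show "\<forall>z\<in>Mt \<times> {0..<T}. h z = u z"
      using visc_solution_eq_classical[OF h u] by blast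
    show "\<forall>z\<in>Mt \<times> {0..T}. h z = u z" if "continuous_on (Mt \<times> {0..T}) h"
      using unique[OF h that] by blast
  qed (fact classical_imp_visc_solution[OF u] cont bounds)+
qed

end
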